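(* Let $F:\mathbb{R}^d\to\mathbb{R}$ be five times continuously differentiable with $\nabla^5F(\mathbf{x})\neq 0$. Suppose there are constants $M>0$ and $m>0$ such that $\|\nabla F(\mathbf{x}_1)-\nabla F(\mathbf{x}_2)\|\le M\|\mathbf{x}_1-\mathbf{x}_2\|$ for all $\mathbf{x}_1,\mathbf{x}_2\in\mathbb{R}^d$, and such that the smallest eigenvalue of the Hessian $\nabla^2F(\mathbf{x})$ is at least $m$ for all $\mathbf{x}\in\mathbb{R}^d$. Let $\mathbf{x}^*$ be the unique minimizer of $F$. Suppose there is a constant $\bar\epsilon_f>0$ such that $|f(\mathbf{x})-F(\mathbf{x})|\le\bar\epsilon_f$ for all $\mathbf{x}\in\mathbb{R}^d$. Let $\mathbf{x}_0$ be the initial point and $\mathbf{x}_{k+1}=\mathbf{x}_k-a_kg_k(\mathbf{x}_k)$ for $k\ge 0$, where $g_k(\mathbf{x}_k)$ is the Cor-CFD gradient estimate and, at the $k$-th iteration, $a_k$ is chosen by the stochastic backtracking line search started from $\tilde a>0$ with parameters $l_1,l_2$ (both described in the context). Let $$\|g_k(\mathbf{x}_k)-\nabla F(\mathbf{x}_k)\|\le\theta\|\nabla F(\mathbf{x}_k)\|$$ at every iteration $k$, where $0<\theta<1$ is a threshold. If $$0<l_1\le\frac{1-\theta}{2(1+\theta)}\le l_2<1,$$ then $a_k>l_2/M$ and $$F(\mathbf{x}_k)-F(\mathbf{x}^* )-\frac{4\bar\epsilon_f}{1-\rho}\le\rho^k\left(F(\mathbf{x}_0)-F(\mathbf{x}^*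 )-\frac{4\bar\epsilon_f}{1-\rho}\right),$$ where $\rho=1-\min\left\{2ml_1\tilde a(1-\theta)^2,\ 2ml_1l_2(1-\theta)^2/M\right\}$.
   Context: $\|\cdot\|$ is the Euclidean norm. The problem is to minimize $F(\mathbf{x})=\mathbb{E}[f(\mathbf{x})]$ over $\mathbb{R}^d$, where only unbiased noisy evaluations $f(\mathbf{x})$ of $F(\mathbf{x})$ are available. Stochastic backtracking line search: at iteration $k$, start from $a_k=\tilde a$. As long as $$f(\mathbf{x}_k-a_kg_k(\mathbf{x}_k))>f(\mathbf{x}_k)-l_1a_k\|g_k(\mathbf{x}_k)\|^2+2\bar\epsilon_f$$ holds, replace $a_k$ by $l_2a_k$ (with $0<l_1<l_2<1$). Stop as soon as this inequality fails, and use the resulting $a_k$. Cor-CFD (correlation-induced central finite-difference) estimate $g_k(\mathbf{x}_k)$ of $\nabla F(\mathbf{x}_k)$, with $n$ sample pairs per coordinate: for each coordinate $i$, with unit vector $\mathbf{e}_i$, write $n=K n_b$ with $K\ge 2$. Draw perturbations $h_1,\dots,h_K$ from a user-specified distribution, and for each $r$ generate $n_b$ independent sample pairs $f_j(\mathbf{x}_k\pm h_r\mathbf{e}_i)$, giving difference quotients $D_{r,j}=\frac{f_j(\mathbf{x}_k+h_r\mathbf{e}_i)-f_j(\mathbf{x}_k-h_r\mathbf{e}_i)}{2h_r}$. Estimate the mean and variance of $\frac1{n_b}\sum_jD_{r,j}$ by the bootstrap for each $r$. Linear regression of the bootstrap means on $(1,h_r^2)$ gives coefficients $(\hat G,\hat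 B)$, and linear regression of the bootstrap variances on $1/(2n_bh_r^2)$ gives an estimate $\hat\tau^2$ of the variance of $f(\mathbf{x}_k)$. Put $\hat h=(\hat\tau^2/(4n\hat B^2))^{1/6}$. The $i$-th component of $g_k(\mathbf{x}_k)$ is the average over all $n$ pairs $(r,j)$ of the adjusted samples $\frac{h_r}{\hat h}\left(D_{r,j}-\hat G-\hat Bh_r^2\right)+\hat G+\hat B\hat h^2$.
   Formalization: The claim a_k > l_2/M is false when ã ≤ l_2/M, since the line search only shrinks the step; it is proved as "a_k > l_2/M or a_k = ã", which gives a_k > l_2/M whenever ã > l_2/M. *)

theory Defs
  imports "HOL-Probability.Probability"
begin

subsection \<open>Smoothness, gradient and Hessian\<close>

text \<open>Continuous differentiability of order \<open>k\<close> on the whole space, by iterating directional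
  derivatives of a Frechet differentiable function.\<close>

primrec continuously_diff :: "nat \<Rightarrow> ('v::real_normed_vector \<Rightarrow> real) \<Rightarrow> bool" where
  "continuously_diff 0 F \<longleftrightarrow> continuous_on UNIV F"
| "continuously_diff (Suc k) F \<longleftrightarrow>
     (\<forall>x. F differentiable (at x)) \<and>
     (\<forall>v. continuously_diff k (\<lambda>x. frechet_derivative F (at x) v))"

text \<open>\<open>iterated_deriv [v\<^sub>1, \<dots>, v\<^sub>p] F x\<close> is the value of the \<open>p\<close>-linear form \<open>\<nabla>\<^sup>p F(x)\<close> at
  \<open>(v\<^sub>1, \<dots>, v\<^sub>p)\<close>.\<close>

primrec iterated_deriv :: "'v::real_normed_vector list \<Rightarrow> ('v \<Rightarrow> real) \<Rightarrow> 'v \<Rightarrow> real" where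
  "iterated_deriv [] F = F"
| "iterated_deriv (v # vs) F = iterated_deriv vs (\<lambda>x. frechet_derivative F (at x) v)"

definition deriv_tensor_nonzero :: "nat \<Rightarrow> ('v::real_normed_vector \<Rightarrow> real) \<Rightarrow> 'v \<Rightarrow> bool" where
  "deriv_tensor_nonzero p F x \<longleftrightarrow> (\<exists>vs. length vs = p \<and> iterated_deriv vs F x \<noteq> 0)"

definition gradient :: "('v::real_inner \<Rightarrow> real) \<Rightarrow> 'v \<Rightarrow> 'v" where
  "gradient F x = (THE D. GDERIV F x :> D)"

definition hessian :: "(real^'d \<Rightarrow> real) \<Rightarrow> real^'d \<Rightarrow> real^'d^'d" where
  "hessian F x = jacobian (gradient F) (at x)"

definition eigenvalues :: "real^'d^'d \<Rightarrow> real set" where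
  "eigenvalues A = {c. \<exists>v. v \<noteq> 0 \<and> A *v v = c *\<^sub>R v}"

text \<open>Used for symmetric matrices only, which have a nonempty finite set of real eigenvalues.\<close>

definition smallest_eigenvalue :: "real^'d^'d \<Rightarrow> real" where
  "smallest_eigenvalue A = Min (eigenvalues A)"

subsection \<open>The Cor-CFD estimate of one partial derivative\<close>

text \<open>A noisy evaluation of the objective at \<open>x\<close> is \<open>f x s\<close>, where the seed \<open>s\<close> carries the
  randomness of that evaluation.\<close>

definition cfd_quotient ::
    "(real^'d \<Rightarrow> 's \<Rightarrow> real) \<Rightarrow> real^'d \<Rightarrow> 'd \<Rightarrow> real \<Rightarrow> 's \<Rightarrow> 's \<Rightarrow> real" where
  "cfd_quotient f x i h s\<^sub>1 s\<^sub>2 =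
     (f (x + h *\<^sub>R axis i 1) s\<^sub>1 - f (x - h *\<^sub>R axis i 1) s\<^sub>2) / (2 * h)"

text \<open>Bootstrap for the average of \<open>D 0, \<dots>, D (n\<^sub>b - 1)\<close> with \<open>N\<close> resamples; \<open>J b j\<close> is the
  index of the observation drawn at position \<open>j\<close> of resample \<open>b\<close>.\<close>

definition resample_average :: "nat \<Rightarrow> (nat \<Rightarrow> nat \<Rightarrow> nat) \<Rightarrow> (nat \<Rightarrow> real) \<Rightarrow> nat \<Rightarrow> real" where
  "resample_average n\<^sub>b J D b = (\<Sum>j<n\<^sub>b. D (J b j)) / real n\<^sub>b"

definition bootstrap_mean :: "nat \<Rightarrow> nat \<Rightarrow> (nat \<Rightarrow> nat \<Rightarrow> nat) \<Rightarrow> (nat \<Rightarrow> real) \<Rightarrow> real" where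
  "bootstrap_mean n\<^sub>b N J D = (\<Sum>b<N. resample_average n\<^sub>b J D b) / real N"

definition bootstrap_variance :: "nat \<Rightarrow> nat \<Rightarrow> (nat \<Rightarrow> nat \<Rightarrow> nat) \<Rightarrow> (nat \<Rightarrow> real) \<Rightarrow> real" where
  "bootstrap_variance n\<^sub>b N J D =
     (\<Sum>b<N. (resample_average n\<^sub>b J D b - bootstrap_mean n\<^sub>b N J D)\<^sup>2) / (real N - 1)"

text \<open>\<open>\<beta>\<close> is a vector of ordinary least squares coefficients for regressing the responses
  \<open>Y 0, \<dots>, Y (K - 1)\<close> on the regressors \<open>X 0, \<dots>, X (K - 1)\<close>; there is no implicit intercept.\<close>

definition least_squares_fit ::
    "nat \<Rightarrow> (nat \<Rightarrow> 'p::real_inner) \<Rightarrow> (nat \<Rightarrow> real) \<Rightarrow> 'p \<Rightarrow> bool" where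
  "least_squares_fit K X Y \<beta> \<longleftrightarrow>
     (\<forall>\<beta>'. (\<Sum>r<K. (Y r - X r \<bullet> \<beta>)\<^sup>2) \<le> (\<Sum>r<K. (Y r - X r \<bullet> \<beta>')\<^sup>2))"

text \<open>\<open>cor_cfd K n\<^sub>b N h D J g\<close>: the adjusted average \<open>g\<close> is a Cor-CFD estimate computed from the
  perturbations \<open>h r\<close>, the difference quotients \<open>D r j\<close> and the resampling indices \<open>J r b j\<close>,
  for \<open>r < K\<close>, \<open>j < n\<^sub>b\<close> and \<open>b < N\<close>. It is a relation because a regression with coinciding
  regressors has several solutions. The convention \<open>x / 0 = 0\<close> applies in the degenerate cases
  \<open>h r = 0\<close>, \<open>B = 0\<close> and \<open>h_hat = 0\<close>.\<close>

definition cor_cfd ::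
    "nat \<Rightarrow> nat \<Rightarrow> nat \<Rightarrow> (nat \<Rightarrow> real) \<Rightarrow> (nat \<Rightarrow> nat \<Rightarrow> real) \<Rightarrow> (nat \<Rightarrow> nat \<Rightarrow> nat \<Rightarrow> nat) \<Rightarrow> real \<Rightarrow> bool"
  where
  "cor_cfd K n\<^sub>b N h D J g \<longleftrightarrow>
     (\<exists>G B \<tau>2 h_hat.
        least_squares_fit K (\<lambda>r. (1, (h r)\<^sup>2)) (\<lambda>r. bootstrap_mean n\<^sub>b N (J r) (D r)) (G, B) \<and>
        least_squares_fit K (\<lambda>r. 1 / (2 * real n\<^sub>b * (h r)\<^sup>2))
          (\<lambda>r. bootstrap_variance n\<^sub>b N (J r) (D r)) \<tau>2 \<and>
        h_hat = (\<tau>2 / (4 * real (K * n\<^sub>b) * B\<^sup>2)) powr (1 / 6) \<and>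
        g = (\<Sum>r<K. \<Sum>j<n\<^sub>b.
               h r / h_hat * (D r j - G - B * (h r)\<^sup>2) + G + B * h_hat\<^sup>2) / real (K * n\<^sub>b))"

subsection \<open>The sources of randomness\<close>

text \<open>Sources are indexed by the iteration \<open>k\<close>, the coordinate \<open>i\<close>, the perturbation number \<open>r\<close>,
  the resample number \<open>b\<close> and the position \<open>j\<close>.\<close>

datatype 'd source =
    Perturbation nat 'd nat
  | Sample_Pair nat 'd nat nat
  | Resampling nat 'd nat nat nat
  | Line_Search nat

text \<open>
  \<^item> \<open>\<Xi>\<close> is the law of a seed and \<open>H\<close> the user-specified law of the perturbations.
  \<^item> \<open>h k i r\<close> is the \<open>r\<close>-th perturbation.
  \<^item> \<open>\<xi>\<^sub>1 k i r j\<close> and \<open>\<xi>\<^sub>2 k i r j\<close> are the seeds of the two evaluations of one sample pair; distinct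
    pairs are independent, the dependence within a pair is arbitrary.
  \<^item> \<open>J k i r b j\<close> are the resampling indices of the bootstrap.
  \<^item> \<open>\<zeta>\<^sub>1 k t\<close> and \<open>\<zeta>\<^sub>2 k t\<close> are the seeds of the evaluations at the current point and at the trial
    point in the \<open>t\<close>-th test of the line search. They may depend on each other arbitrarily, so that
    \<open>f(x\<^sub>k)\<close> may be evaluated once per iteration or anew for every test.
\<close>

locale cor_cfd_sampling =
  \<Omega>: prob_space \<Omega> + \<Xi>: prob_space \<Xi>
  for \<Omega> :: "'w measure" and \<Xi> :: "'s measure" +
  fixes H :: "real measure"
    and F :: "real^'d \<Rightarrow> real"
    and f :: "real^'d \<Rightarrow> 's \<Rightarrow> real"
    and K n\<^sub>b N :: nat
    and h :: "nat \<Rightarrow> 'd \<Rightarrow> nat \<Rightarrow> 'w \<Rightarrow> real"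
    and \<xi>\<^sub>1 \<xi>\<^sub>2 :: "nat \<Rightarrow> 'd \<Rightarrow> nat \<Rightarrow> nat \<Rightarrow> 'w \<Rightarrow> 's"
    and J :: "nat \<Rightarrow> 'd \<Rightarrow> nat \<Rightarrow> nat \<Rightarrow> nat \<Rightarrow> 'w \<Rightarrow> nat"
    and \<zeta>\<^sub>1 \<zeta>\<^sub>2 :: "nat \<Rightarrow> nat \<Rightarrow> 'w \<Rightarrow> 's"
  assumes integrable: "integrable \<Xi> (f x)"
    and unbiased: "(\<integral>s. f x s \<partial>\<Xi>) = F x"
    and sizes: "2 \<le> K" "1 \<le> n\<^sub>b" "2 \<le> N"
    and h_measurable: "r < K \<Longrightarrow> h k i r \<in> borel_measurable \<Omega>"
    and h_law: "r < K \<Longrightarrow> distr \<Omega> borel (h k i r) = H"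
    and pair_measurable:
      "r < K \<Longrightarrow> j < n\<^sub>b \<Longrightarrow> \<xi>\<^sub>1 k i r j \<in> measurable \<Omega> \<Xi>"
      "r < K \<Longrightarrow> j < n\<^sub>b \<Longrightarrow> \<xi>\<^sub>2 k i r j \<in> measurable \<Omega> \<Xi>"
    and pair_law:
      "r < K \<Longrightarrow> j < n\<^sub>b \<Longrightarrow> distr \<Omega> \<Xi> (\<xi>\<^sub>1 k i r j) = \<Xi>"
      "r < K \<Longrightarrow> j < n\<^sub>b \<Longrightarrow> distr \<Omega> \<Xi> (\<xi>\<^sub>2 k i r j) = \<Xi>"
    and index_measurable: "r < K \<Longrightarrow> b < N \<Longrightarrow> j < n\<^sub>b \<Longrightarrow>
      J k i r b j \<in> measurable \<Omega> (uniform_count_measure {..<n\<^sub>b})"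
    and index_law: "r < K \<Longrightarrow> b < N \<Longrightarrow> j < n\<^sub>b \<Longrightarrow>
      distr \<Omega> (uniform_count_measure {..<n\<^sub>b}) (J k i r b j) = uniform_count_measure {..<n\<^sub>b}"
    and search_measurable: "\<zeta>\<^sub>1 k t \<in> measurable \<Omega> \<Xi>" "\<zeta>\<^sub>2 k t \<in> measurable \<Omega> \<Xi>"
    and search_law: "distr \<Omega> \<Xi> (\<zeta>\<^sub>1 k t) = \<Xi>" "distr \<Omega> \<Xi> (\<zeta>\<^sub>2 k t) = \<Xi>"
    and independent:
      "\<Omega>.indep_sets
         (\<lambda>src. case src of
            Perturbation k i r \<Rightarrow> sets (vimage_algebra (space \<Omega>) (h k i r) borel)
          | Sample_Pair k i r j \<Rightarrow>
              sets (vimage_algebra (space \<Omega>) (\<lambda>\<omega>. (\<xi>\<^sub>1 k i r j \<omega>, \<xi>\<^sub>2 k i r j \<omega>)) (\<Xi> \<Otimes>\<^sub>M \<Xi>))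
          | Resampling k i r b j \<Rightarrow>
              sets (vimage_algebra (space \<Omega>) (J k i r b j) (uniform_count_measure {..<n\<^sub>b}))
          | Line_Search k \<Rightarrow>
              sets (vimage_algebra (space \<Omega>) (\<lambda>\<omega> t. (\<zeta>\<^sub>1 k t \<omega>, \<zeta>\<^sub>2 k t \<omega>))
                (Pi\<^sub>M UNIV (\<lambda>_. \<Xi> \<Otimes>\<^sub>M \<Xi>))))
         ({Perturbation k i r |k i r. r < K} \<union>
          {Sample_Pair k i r j |k i r j. r < K \<and> j < n\<^sub>b} \<union>
          {Resampling k i r b j |k i r b j. r < K \<and> b < N \<and> j < n\<^sub>b} \<union>
          range Line_Search)"

subsection \<open>Stochastic backtracking line search\<close>

text \<open>The condition under which the step size \<open>\<alpha>\<close> is shrunk further, with \<open>s\<^sub>1\<close> and \<open>s\<^sub>2\<close> the seeds of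
  the evaluations at the current and at the trial point.\<close>

definition step_rejected ::
    "(real^'d \<Rightarrow> 's \<Rightarrow> real) \<Rightarrow> real \<Rightarrow> real \<Rightarrow> real^'d \<Rightarrow> real^'d \<Rightarrow> 's \<Rightarrow> 's \<Rightarrow> real \<Rightarrow> bool" where
  "step_rejected f \<epsilon> l\<^sub>1 x g s\<^sub>1 s\<^sub>2 \<alpha> \<longleftrightarrow>
     f (x - \<alpha> *\<^sub>R g) s\<^sub>2 > f x s\<^sub>1 - l\<^sub>1 * \<alpha> * (norm g)\<^sup>2 + 2 * \<epsilon>"

text \<open>The step size after \<open>t\<close> reductions is \<open>l\<^sub>2 ^ t * a_init\<close>, and \<open>s\<^sub>1 t\<close>, \<open>s\<^sub>2 t\<close> are the seeds used to
  test it. The result is unspecified if every trial is rejected; termination is not presupposed.\<close>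

definition backtracking_step ::
    "(real^'d \<Rightarrow> 's \<Rightarrow> real) \<Rightarrow> real \<Rightarrow> real \<Rightarrow> real \<Rightarrow> real \<Rightarrow> real^'d \<Rightarrow> real^'d
      \<Rightarrow> (nat \<Rightarrow> 's) \<Rightarrow> (nat \<Rightarrow> 's) \<Rightarrow> real" where
  "backtracking_step f \<epsilon> l\<^sub>1 l\<^sub>2 a_init x g s\<^sub>1 s\<^sub>2 =
     l\<^sub>2 ^ (LEAST t. \<not> step_rejected f \<epsilon> l\<^sub>1 x g (s\<^sub>1 t) (s\<^sub>2 t) (l\<^sub>2 ^ t * a_init)) * a_init"

end

theory Submission
  imports Defs
begin

text \<open>
  The argument is pathwise: it concerns one fixed outcome, and the randomness enters through the
  uniform bound on the evaluation errors and the relative accuracy of the gradient estimates. Write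
  \<open>G\<close> for the gradient at the current point \<open>y\<close> and \<open>g\<close> for its estimate.

  The step size. The error bound gives \<open>G \<bullet> g \<ge> |g|\<^sup>2 / (1 + \<theta>)\<close>
  (\<open>inner_estimate_lower\<close>). If \<open>\<alpha>\<close> is rejected, the two evaluation errors are absorbed by the slack
  \<open>2 \<epsilon>\<close>, so \<open>F (y - \<alpha> g) > F y - l\<^sub>1 \<alpha> |g|\<^sup>2\<close>. Against the upper bound
  \<open>F (y - \<alpha> g) \<le> F y - \<alpha> G \<bullet> g + M \<alpha>\<^sup>2 |g|\<^sup>2 / 2\<close> this forces
  \<open>M \<alpha> / 2 > 1 / (1 + \<theta>) - l\<^sub>1 \<ge> 1 / 2\<close>, that is \<open>\<alpha> > 1 / M\<close> (\<open>rejected_step_large\<close>). Hence the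
  search terminates, and it returns either the initial step size or more than \<open>l\<^sub>2 / M\<close>.

  The rate. An accepted step \<open>a\<close> gives \<open>F (y - a g) \<le> F y - l\<^sub>1 a |g|\<^sup>2 + 4 \<epsilon>\<close>. Combined with
  \<open>|g| \<ge> (1 - \<theta>) |G|\<close> and the Polyak-Lojasiewicz inequality \<open>|G|\<^sup>2 \<ge> 2 m (F y - min F)\<close>
  (\<open>gradient_dominates_gap\<close>), the gap contracts by \<open>\<rho>\<close> up to \<open>4 \<epsilon>\<close> per iteration. Iterating needs
  \<open>\<rho> \<ge> 0\<close>, which follows from \<open>m \<le> M\<close>, \<open>2 l\<^sub>1 \<le> 1\<close> and \<open>l\<^sub>2 < 1\<close>.

  The Polyak-Lojasiewicz inequality is a consequence of strong convexity, for which the bound on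
  the smallest eigenvalue has to become a bound on the quadratic form of the Hessian. That is the
  variational characterization of the smallest eigenvalue of a symmetric matrix
  (\<open>smallest_eigenvalue_le_quadratic_form\<close>), and the Hessian is symmetric because second
  derivatives commute (\<open>second_derivative_commute\<close>).
\<close>

section \<open>Symmetry of second derivatives\<close>

lemma continuously_diff_mono:
  assumes "continuously_diff k F" "j \<le> k"
  shows "continuously_diff j F"
proof -
  have step: "continuously_diff (Suc k) F \<Longrightarrow> continuously_diff k F" for k and F :: "'a \<Rightarrow> real"
  proof (induction k arbitrary: F)
    case 0
    then show ?case
      by (auto simp: continuous_on_eq_continuous_at intro: differentiable_imp_continuous_within)
  next
    case (Suc k)
    from Suc.prems have "F differentiable (at x)" for x by simp
    moreover have "continuously_diff k (\<lambda>x. frechet_derivative F (at x) v)" for v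
      using Suc.prems unfolding continuously_diff.simps(2)[of "Suc k"] by (blast intro: Suc.IH)
    ultimately show ?case
      unfolding continuously_diff.simps(2) by blast
  qed
  show ?thesis
    using assms(2,1) by (induction rule: inc_induct) (auto simp only: step)
qed

lemma DERIV_along_line:
  fixes F :: "'v::real_normed_vector \<Rightarrow> real"
  assumes "F differentiable (at (p + t *\<^sub>R v))"
  shows "((\<lambda>t. F (p + t *\<^sub>R v)) has_real_derivative
          frechet_derivative F (at (p + t *\<^sub>R v)) v) (at t)"
proof -
  have F: "(F has_derivative frechet_derivative F (at (p + t *\<^sub>R v))) (at (p + t *\<^sub>R v))"
    using assms frechet_derivative_works by blast
  have line: "((\<lambda>t. p + t *\<^sub>R v) has_derivative (\<lambda>s. s *\<^sub>R v)) (at t)"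
    by (auto intro!: derivative_eq_intros)
  have "((\<lambda>t. F (p + t *\<^sub>R v)) has_derivative
          (\<lambda>s. frechet_derivative F (at (p + t *\<^sub>R v)) (s *\<^sub>R v))) (at t)"
    using has_derivative_compose[OF line F] by simp
  moreover have "frechet_derivative F (at (p + t *\<^sub>R v)) (s *\<^sub>R v)
      = frechet_derivative F (at (p + t *\<^sub>R v)) v * s" for s
    using linear_frechet_derivative[OF assms] by (simp add: linear_cmul)
  ultimately show ?thesis
    by (simp add: has_field_derivative_def)
qed

text \<open>The second difference over a parallelogram is \<open>h\<^sup>2\<close> times a mixed derivative at an interior
  point. It is symmetric in \<open>v\<close> and \<open>w\<close>, so letting \<open>h\<close> tend to zero shows that continuous mixed
  derivatives commute.\<close>

lemma second_difference_mvt: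
  fixes F :: "'v::real_normed_vector \<Rightarrow> real"
  assumes F: "\<And>x. F differentiable (at x)"
    and Fv: "\<And>x. (\<lambda>x. frechet_derivative F (at x) v) differentiable (at x)"
    and h: "0 < h"
  obtains s t where "0 < s" "s < h" "0 < t" "t < h"
    "F (x + h *\<^sub>R v + h *\<^sub>R w) - F (x + h *\<^sub>R v) - F (x + h *\<^sub>R w) + F x
       = h\<^sup>2 * frechet_derivative (\<lambda>x. frechet_derivative F (at x) v) (at (x + s *\<^sub>R v + t *\<^sub>R w)) w"
proof -
  define \<phi> where "\<phi> s = F ((x + h *\<^sub>R w) + s *\<^sub>R v) - F (x + s *\<^sub>R v)" for s
  have "(\<phi> has_real_derivative
      frechet_derivative F (at ((x + h *\<^sub>R w) + s *\<^sub>R v)) v - frechet_derivative F (at (x + s *\<^sub>R v)) v)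
      (at s)" for s
    unfolding \<phi>_def by (intro derivative_intros DERIV_along_line F)
  from MVT2[of 0 h \<phi>, OF h this] obtain s where s: "0 < s" "s < h"
    and 1: "\<phi> h - \<phi> 0 = h * (frechet_derivative F (at ((x + h *\<^sub>R w) + s *\<^sub>R v)) v
                             - frechet_derivative F (at (x + s *\<^sub>R v)) v)"
    by auto
  define \<psi> where "\<psi> t = frechet_derivative F (at ((x + s *\<^sub>R v) + t *\<^sub>R w)) v" for t
  have "(\<psi> has_real_derivative
      frechet_derivative (\<lambda>x. frechet_derivative F (at x) v) (at ((x + s *\<^sub>R v) + t *\<^sub>R w)) w) (at t)"
    for t
    unfolding \<psi>_def by (rule DERIV_along_line[OF Fv])
  from MVT2[of 0 h \<psi>, OF h this] obtain t where t: "0 < t" "t < h"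
    and 2: "\<psi> h - \<psi> 0
      = h * frechet_derivative (\<lambda>x. frechet_derivative F (at x) v) (at ((x + s *\<^sub>R v) + t *\<^sub>R w)) w"
    by auto
  show thesis
  proof (rule that[OF s t])
    show "F (x + h *\<^sub>R v + h *\<^sub>R w) - F (x + h *\<^sub>R v) - F (x + h *\<^sub>R w) + F x
       = h\<^sup>2 * frechet_derivative (\<lambda>x. frechet_derivative F (at x) v) (at (x + s *\<^sub>R v + t *\<^sub>R w)) w"
      using 1 2 unfolding \<phi>_def \<psi>_def by (simp add: power2_eq_square algebra_simps)
  qed
qed

lemma second_derivative_commute:
  fixes F :: "'v::real_normed_vector \<Rightarrow> real"
  assumes "continuously_diff 2 F"
  shows "frechet_derivative (\<lambda>x. frechet_derivative F (at x) v) (at x) w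
       = frechet_derivative (\<lambda>x. frechet_derivative F (at x) w) (at x) v"
proof -
  define D where "D v w y = frechet_derivative (\<lambda>x. frechet_derivative F (at x) v) (at y) w" for v w y
  have F: "F differentiable (at y)" for y
    using assms by (simp add: numeral_2_eq_2)
  have DF: "(\<lambda>x. frechet_derivative F (at x) v) differentiable (at y)" for v y
    using assms by (simp add: numeral_2_eq_2)
  have cont: "isCont (D v w) y" for v w y
    using assms unfolding D_def by (simp add: numeral_2_eq_2 continuous_on_eq_continuous_at)
  have "\<bar>D v w x - D w v x\<bar> \<le> e" if "0 < e" for e
  proof -
    obtain d1 where d1: "0 < d1" "\<And>y. dist y x < d1 \<Longrightarrow> dist (D v w y) (D v w x) < e / 2"
      using cont[of x v w] \<open>0 < e\<close> unfolding continuous_at_eps_delta by (meson half_gt_zero)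
    obtain d2 where d2: "0 < d2" "\<And>y. dist y x < d2 \<Longrightarrow> dist (D w v y) (D w v x) < e / 2"
      using cont[of x w v] \<open>0 < e\<close> unfolding continuous_at_eps_delta by (meson half_gt_zero)
    define d where "d = min d1 d2"
    define h where "h = d / (norm v + norm w + 1)"
    have "0 < d" using d1 d2 by (simp add: d_def)
    have n: "0 < norm v + norm w + 1" by (simp add: add_nonneg_pos)
    have "0 < h" using \<open>0 < d\<close> n by (simp add: h_def)
    have near: "dist (x + s *\<^sub>R p + t *\<^sub>R q) x < d"
      if "0 < s" "s < h" "0 < t" "t < h" "norm p + norm q = norm v + norm w" for s t p q
    proof -
      have "dist (x + s *\<^sub>R p + t *\<^sub>R q) x = norm (s *\<^sub>R p + t *\<^sub>R q)"
        by (simp add: dist_norm)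
      also have "\<dots> \<le> s * norm p + t * norm q"
        using that norm_triangle_ineq[of "s *\<^sub>R p" "t *\<^sub>R q"] by simp
      also have "\<dots> \<le> h * norm p + h * norm q"
        using that by (intro add_mono mult_right_mono) auto
      also have "\<dots> = h * (norm v + norm w)"
        using that by (simp flip: distrib_left)
      also have "\<dots> < h * (norm v + norm w + 1)"
        using \<open>0 < h\<close> by simp
      also have "\<dots> = d"
        using n by (simp add: h_def)
      finally show ?thesis .
    qed
    obtain s t where st: "0 < s" "s < h" "0 < t" "t < h"
      and 1: "F (x + h *\<^sub>R v + h *\<^sub>R w) - F (x + h *\<^sub>R v) - F (x + h *\<^sub>R w) + F x
        = h\<^sup>2 * D v w (x + s *\<^sub>R v + t *\<^sub>R w)"
      using second_difference_mvt[OF F DF \<open>0 < h\<close>] unfolding D_def by metis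
    obtain s' t' where st': "0 < s'" "s' < h" "0 < t'" "t' < h"
      and 2: "F (x + h *\<^sub>R w + h *\<^sub>R v) - F (x + h *\<^sub>R w) - F (x + h *\<^sub>R v) + F x
        = h\<^sup>2 * D w v (x + s' *\<^sub>R w + t' *\<^sub>R v)"
      using second_difference_mvt[OF F DF \<open>0 < h\<close>] unfolding D_def by metis
    have swap: "x + h *\<^sub>R w + h *\<^sub>R v = x + h *\<^sub>R v + h *\<^sub>R w"
      by (simp add: add_ac)
    have "h\<^sup>2 * D v w (x + s *\<^sub>R v + t *\<^sub>R w) = h\<^sup>2 * D w v (x + s' *\<^sub>R w + t' *\<^sub>R v)"
      using 1 2[unfolded swap] by linarith
    then have "D v w (x + s *\<^sub>R v + t *\<^sub>R w) = D w v (x + s' *\<^sub>R w + t' *\<^sub>R v)"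
      using \<open>0 < h\<close> by simp
    moreover have "dist (D v w (x + s *\<^sub>R v + t *\<^sub>R w)) (D v w x) < e / 2"
      using near[OF st] by (intro d1) (simp add: d_def)
    moreover have "dist (D w v (x + s' *\<^sub>R w + t' *\<^sub>R v)) (D w v x) < e / 2"
      using near[OF st'] by (intro d2) (simp add: d_def)
    ultimately show ?thesis unfolding dist_real_def by linarith
  qed
  then have "\<bar>D v w x - D w v x\<bar> \<le> 0"
    by (rule field_le_epsilon[where y = 0, simplified])
  then show ?thesis by (simp add: D_def)
qed

section \<open>The smallest eigenvalue of a symmetric matrix\<close>

text \<open>Eigenvectors for distinct eigenvalues are orthogonal, hence independent. Finiteness is what
  gives \<open>Min\<close> in the definition of the smallest eigenvalue its meaning.\<close>

lemma finite_eigenvalues: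
  fixes A :: "real^'d^'d"
  assumes sym: "\<And>v w. (A *v v) \<bullet> w = v \<bullet> (A *v w)"
  shows "finite (eigenvalues A)"
proof -
  define u where "u c = (SOME v. v \<noteq> 0 \<and> A *v v = c *\<^sub>R v)" for c
  have u: "u c \<noteq> 0 \<and> A *v u c = c *\<^sub>R u c" if "c \<in> eigenvalues A" for c
    using someI_ex[of "\<lambda>v. v \<noteq> 0 \<and> A *v v = c *\<^sub>R v"] that
    unfolding u_def eigenvalues_def by blast
  have inj: "inj_on u (eigenvalues A)"
    by (rule inj_onI) (metis u scaleR_right_imp_eq)
  have orth: "u c \<bullet> u c' = 0" if "c \<in> eigenvalues A" "c' \<in> eigenvalues A" "c \<noteq> c'" for c c'
    using sym[of "u c" "u c'"] u[OF that(1)] u[OF that(2)] that(3) by simp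
  have "pairwise orthogonal (u ` eigenvalues A)"
    using orth by (auto simp: pairwise_def orthogonal_def)
  moreover have "0 \<notin> u ` eigenvalues A"
    using u by force
  ultimately have "finite (u ` eigenvalues A)"
    by (intro independent_imp_finite pairwise_orthogonal_independent)
  then show ?thesis
    using inj finite_imageD by blast
qed

text \<open>A minimizer \<open>u\<close> of the quadratic form on the unit sphere, with value \<open>c\<close>, is an eigenvector:
  the form \<open>v \<bullet> A v - c |v|\<^sup>2\<close> is nonnegative and vanishes at \<open>u\<close>, so its gradient
  \<open>2 (A u - c u)\<close> vanishes there.\<close>

lemma smallest_eigenvalue_le_quadratic_form:
  fixes A :: "real^'d^'d"
  assumes sym: "\<And>v w. (A *v v) \<bullet> w = v \<bullet> (A *v w)"
  shows "smallest_eigenvalue A * (norm v)\<^sup>2 \<le> v \<bullet> (A *v v)"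
proof -
  define q where "q v = v \<bullet> (A *v v)" for v
  have "continuous_on (sphere 0 1) q"
    unfolding q_def by (intro continuous_intros)
  moreover have "sphere (0::real^'d) 1 \<noteq> {}"
    by simp
  ultimately obtain u where u: "norm u = 1" and u_min: "\<And>y. norm y = 1 \<Longrightarrow> q u \<le> q y"
    using continuous_attains_inf[of "sphere 0 1" q] by (auto simp: dist_norm)
  define c where "c = q u"
  have lower: "c * (norm y)\<^sup>2 \<le> q y" for y
  proof (cases "y = 0")
    case False
    have "c \<le> q ((1 / norm y) *\<^sub>R y)"
      unfolding c_def using False by (intro u_min) simp
    also have "\<dots> = q y / (norm y)\<^sup>2"
      by (simp add: q_def matrix_vector_mult_scaleR power2_eq_square)
    finally show ?thesis
      using False by (simp add: field_simps)
  qed (simp add: q_def)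
  define r where "r = A *v u - c *\<^sub>R u"
  define b where "b = q r - c * (norm r)\<^sup>2"
  define R where "R = (norm r)\<^sup>2"
  have "0 \<le> b" "0 \<le> R"
    using lower[of r] by (simp_all add: b_def R_def)
  have "0 \<le> 2 * t * R + t\<^sup>2 * b" for t
  proof -
    have ru: "r \<bullet> (A *v u) = R + c * (r \<bullet> u)"
      unfolding R_def power2_norm_eq_inner by (simp add: r_def algebra_simps inner_diff_right)
    have "q (u + t *\<^sub>R r) = c + 2 * t * (r \<bullet> (A *v u)) + t\<^sup>2 * q r"
      using sym[of u r]
      by (simp add: q_def c_def matrix_vector_right_distrib matrix_vector_mult_scaleR
          inner_add inner_commute power2_eq_square algebra_simps)
    moreover have "(norm (u + t *\<^sub>R r))\<^sup>2 = 1 + 2 * t * (r \<bullet> u) + t\<^sup>2 * (norm r)\<^sup>2"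
    proof -
      have "u \<bullet> u = 1" using u by (simp add: norm_eq_1)
      then show ?thesis unfolding power2_norm_eq_inner
        by (simp add: inner_add inner_commute power2_eq_square algebra_simps)
    qed
    ultimately show ?thesis
      using lower[of "u + t *\<^sub>R r"] ru by (simp add: b_def algebra_simps)
  qed
  \<comment> \<open>The minimum over \<open>t\<close> lies at \<open>- R / b\<close>; adding one to the denominator covers \<open>b = 0\<close>.\<close>
  from this[of "- R / (b + 1)"] have "R = 0"
  proof -
    assume "0 \<le> 2 * (- R / (b + 1)) * R + (- R / (b + 1))\<^sup>2 * b"
    also have "\<dots> = - (R\<^sup>2 * (b + 2) / (b + 1)\<^sup>2)"
      using \<open>0 \<le> b\<close> by (simp add: divide_simps power2_eq_square) (simp add: algebra_simps)
    finally have "R\<^sup>2 * (b + 2) / (b + 1)\<^sup>2 \<le> 0" by simp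
    then show "R = 0"
      using \<open>0 \<le> b\<close> by (auto simp: divide_le_0_iff mult_le_0_iff)
  qed
  then have "A *v u = c *\<^sub>R u"
    by (simp add: R_def r_def)
  moreover have "u \<noteq> 0" using u by auto
  ultimately have "c \<in> eigenvalues A"
    by (auto simp: eigenvalues_def)
  then have "smallest_eigenvalue A \<le> c"
    unfolding smallest_eigenvalue_def using finite_eigenvalues[OF sym] by (intro Min_le)
  then have "smallest_eigenvalue A * (norm v)\<^sup>2 \<le> c * (norm v)\<^sup>2"
    by (intro mult_right_mono) auto
  also have "\<dots> \<le> q v" by (rule lower)
  finally show ?thesis by (simp add: q_def)
qed

section \<open>Gradient and Hessian\<close>

text \<open>Differentiability makes the definite description in \<open>gradient\<close> well defined, and identifies
  it with the Riesz representative of the derivative.\<close>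

lemma gradient_inner:
  fixes F :: "'v::euclidean_space \<Rightarrow> real"
  assumes "F differentiable (at x)"
  shows "gradient F x \<bullet> v = frechet_derivative F (at x) v"
proof -
  define D where "D = (\<Sum>b\<in>Basis. frechet_derivative F (at x) b *\<^sub>R b)"
  have lin: "linear (frechet_derivative F (at x))"
    by (rule linear_frechet_derivative[OF assms])
  have D: "D \<bullet> v = frechet_derivative F (at x) v" for v
  proof -
    have "frechet_derivative F (at x) v = frechet_derivative F (at x) (\<Sum>b\<in>Basis. (v \<bullet> b) *\<^sub>R b)"
      by (simp add: euclidean_representation)
    also have "\<dots> = (\<Sum>b\<in>Basis. frechet_derivative F (at x) b * (b \<bullet> v))"
      by (simp add: linear_sum[OF lin] linear_cmul[OF lin] inner_commute mult.commute)
    also have "\<dots> = D \<bullet> v"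
      by (simp add: D_def inner_sum_left)
    finally show ?thesis by simp
  qed
  then have "GDERIV F x :> D"
    unfolding gderiv_def using assms by (simp add: inner_commute frechet_derivative_works)
  moreover have "E = D" if "GDERIV F x :> E" for E
  proof -
    have "frechet_derivative F (at x) = (\<lambda>h. h \<bullet> E)"
      using that frechet_derivative_at unfolding gderiv_def by metis
    then have "D \<bullet> v = E \<bullet> v" for v by (simp add: D inner_commute)
    then show ?thesis by (metis vector_eq_rdot)
  qed
  ultimately have "gradient F x = D"
    unfolding gradient_def by (rule the_equality)
  then show ?thesis by (simp add: D)
qed

lemma hessian_inner:
  fixes F :: "real^'d \<Rightarrow> real"
  assumes "continuously_diff 2 F"
  shows "(hessian F x *v w) \<bullet> v = frechet_derivative (\<lambda>y. frechet_derivative F (at y) v) (at x) w"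
proof -
  have F: "F differentiable (at y)" for y
    using assms by (simp add: numeral_2_eq_2)
  have DF: "(\<lambda>x. frechet_derivative F (at x) v) differentiable (at y)" for v y
    using assms by (simp add: numeral_2_eq_2)
  have "gradient F differentiable (at x)"
    unfolding differentiable_componentwise_within[of "gradient F" x UNIV]
    by (simp add: gradient_inner[OF F] DF)
  then have "(gradient F has_derivative (\<lambda>h. hessian F x *v h)) (at x)"
    unfolding hessian_def using jacobian_works by blast
  then have "((\<lambda>y. gradient F y \<bullet> v) has_derivative (\<lambda>h. (hessian F x *v h) \<bullet> v)) (at x)"
    by (rule has_derivative_inner_left)
  then have "((\<lambda>y. frechet_derivative F (at y) v) has_derivative (\<lambda>h. (hessian F x *v h) \<bullet> v)) (at x)"
    by (simp add: gradient_inner[OF F])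
  from frechet_derivative_at[OF this] show ?thesis by metis
qed

lemma hessian_symmetric:
  fixes F :: "real^'d \<Rightarrow> real"
  assumes "continuously_diff 2 F"
  shows "(hessian F x *v v) \<bullet> w = v \<bullet> (hessian F x *v w)"
proof -
  have "(hessian F x *v v) \<bullet> w = (hessian F x *v w) \<bullet> v"
    unfolding hessian_inner[OF assms] by (rule second_derivative_commute[OF assms])
  then show ?thesis
    by (simp only: inner_commute)
qed

section \<open>Smoothness and strong convexity\<close>

lemma DERIV_gradient_along_line:
  fixes F :: "'v::euclidean_space \<Rightarrow> real"
  assumes "\<And>y. F differentiable (at y)"
  shows "((\<lambda>t. F (y + t *\<^sub>R p)) has_real_derivative gradient F (y + t *\<^sub>R p) \<bullet> p) (at t)"
  using DERIV_along_line[OF assms] by (simp add: gradient_inner[OF assms])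

lemma lipschitz_gradient_upper_bound:
  fixes F :: "'v::euclidean_space \<Rightarrow> real"
  assumes F: "\<And>y. F differentiable (at y)"
    and lip: "\<And>y z. norm (gradient F y - gradient F z) \<le> M * norm (y - z)"
  shows "F (y + p) \<le> F y + gradient F y \<bullet> p + M / 2 * (norm p)\<^sup>2"
proof -
  define \<phi> where "\<phi> t = F (y + t *\<^sub>R p) - t * (gradient F y \<bullet> p) - M / 2 * t\<^sup>2 * (norm p)\<^sup>2" for t
  have deriv: "(\<phi> has_real_derivative
      gradient F (y + t *\<^sub>R p) \<bullet> p - gradient F y \<bullet> p - M * t * (norm p)\<^sup>2) (at t)" for t
    unfolding \<phi>_def by (auto intro!: derivative_eq_intros DERIV_gradient_along_line[OF F])
  have nonpos: "gradient F (y + t *\<^sub>R p) \<bullet> p - gradient F y \<bullet> p - M * t * (norm p)\<^sup>2 \<le> 0" if "0 \<le> t" for t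
  proof -
    have "gradient F (y + t *\<^sub>R p) \<bullet> p - gradient F y \<bullet> p
        \<le> norm (gradient F (y + t *\<^sub>R p) - gradient F y) * norm p"
      by (metis inner_diff_left norm_cauchy_schwarz)
    also have "\<dots> \<le> (M * norm (t *\<^sub>R p)) * norm p"
      using lip[of "y + t *\<^sub>R p" y] by (intro mult_right_mono) auto
    finally show ?thesis
      using that by (simp add: power2_eq_square mult_ac)
  qed
  have "\<phi> 1 \<le> \<phi> 0"
    by (rule DERIV_nonpos_imp_nonincreasing[of 0 1 \<phi>])
      (simp, intro exI conjI, rule deriv, rule nonpos)
  then show ?thesis by (simp add: \<phi>_def)
qed

lemma gradient_strongly_monotone:
  fixes F :: "real^'d \<Rightarrow> real"
  assumes C2: "continuously_diff 2 F"
    and low: "\<And>y. m \<le> smallest_eigenvalue (hessian F y)"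
  shows "m * (norm p)\<^sup>2 \<le> (gradient F (y + p) - gradient F y) \<bullet> p"
proof -
  have F: "F differentiable (at y)" for y
    using C2 by (simp add: numeral_2_eq_2)
  have DF: "(\<lambda>x. frechet_derivative F (at x) v) differentiable (at y)" for v y
    using C2 by (simp add: numeral_2_eq_2)
  define \<phi> where "\<phi> t = frechet_derivative F (at (y + t *\<^sub>R p)) p - t * (m * (norm p)\<^sup>2)" for t
  have deriv: "(\<phi> has_real_derivative
      frechet_derivative (\<lambda>x. frechet_derivative F (at x) p) (at (y + t *\<^sub>R p)) p - m * (norm p)\<^sup>2)
      (at t)" for t
    unfolding \<phi>_def by (auto intro!: derivative_eq_intros DERIV_along_line[OF DF])
  have "m * (norm p)\<^sup>2
      \<le> frechet_derivative (\<lambda>x. frechet_derivative F (at x) p) (at (y + t *\<^sub>R p)) p" for t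
  proof -
    have "m * (norm p)\<^sup>2 \<le> smallest_eigenvalue (hessian F (y + t *\<^sub>R p)) * (norm p)\<^sup>2"
      using low by (intro mult_right_mono) auto
    also have "\<dots> \<le> p \<bullet> (hessian F (y + t *\<^sub>R p) *v p)"
      by (rule smallest_eigenvalue_le_quadratic_form[OF hessian_symmetric[OF C2]])
    finally show ?thesis
      by (metis hessian_inner[OF C2] inner_commute)
  qed
  then have "0 \<le> frechet_derivative (\<lambda>x. frechet_derivative F (at x) p) (at (y + t *\<^sub>R p)) p
      - m * (norm p)\<^sup>2" for t
    by simp
  with deriv have "\<phi> 0 \<le> \<phi> 1"
    by (intro DERIV_nonneg_imp_nondecreasing[of 0 1 \<phi>]) (simp, blast)
  then show ?thesis
    by (simp add: \<phi>_def inner_diff_left gradient_inner[OF F])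
qed

lemma strong_convexity_lower_bound:
  fixes F :: "real^'d \<Rightarrow> real"
  assumes C2: "continuously_diff 2 F"
    and low: "\<And>y. m \<le> smallest_eigenvalue (hessian F y)"
  shows "F y + gradient F y \<bullet> p + m / 2 * (norm p)\<^sup>2 \<le> F (y + p)"
proof -
  have F: "F differentiable (at y)" for y
    using C2 by (simp add: numeral_2_eq_2)
  define \<phi> where "\<phi> t = F (y + t *\<^sub>R p) - t * (gradient F y \<bullet> p) - m / 2 * t\<^sup>2 * (norm p)\<^sup>2" for t
  have deriv: "(\<phi> has_real_derivative
      gradient F (y + t *\<^sub>R p) \<bullet> p - gradient F y \<bullet> p - m * t * (norm p)\<^sup>2) (at t)" for t
    unfolding \<phi>_def by (auto intro!: derivative_eq_intros DERIV_gradient_along_line[OF F])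
  have nonneg: "0 \<le> gradient F (y + t *\<^sub>R p) \<bullet> p - gradient F y \<bullet> p - m * t * (norm p)\<^sup>2" if "0 \<le> t" for t
  proof (cases "t = 0")
    case False
    have "t * (m * t * (norm p)\<^sup>2) \<le> t * ((gradient F (y + t *\<^sub>R p) - gradient F y) \<bullet> p)"
      using gradient_strongly_monotone[OF C2 low, of "t *\<^sub>R p" y]
      by (simp add: power2_eq_square mult_ac)
    then show ?thesis
      using False that by (simp add: inner_diff_left)
  qed simp
  have "\<phi> 0 \<le> \<phi> 1"
    by (rule DERIV_nonneg_imp_nondecreasing[of 0 1 \<phi>])
      (simp, intro exI conjI, rule deriv, rule nonneg)
  then show ?thesis by (simp add: \<phi>_def)
qed

text \<open>The Polyak-Lojasiewicz inequality: complete the square in the strong convexity bound, which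
  is smallest at the displacement \<open>- G / m\<close>, with \<open>G\<close> the gradient.\<close>

lemma gradient_dominates_gap:
  fixes F :: "real^'d \<Rightarrow> real"
  assumes C2: "continuously_diff 2 F" and m: "0 < m"
    and low: "\<And>y. m \<le> smallest_eigenvalue (hessian F y)"
  shows "2 * m * (F y - F z) \<le> (norm (gradient F y))\<^sup>2"
proof -
  let ?G = "gradient F y"
  define p where "p = z - y"
  have "F y + ?G \<bullet> p + m / 2 * (norm p)\<^sup>2 \<le> F z"
    using strong_convexity_lower_bound[OF C2 low, of y p] by (simp add: p_def)
  then have "2 * m * (F y + ?G \<bullet> p + m / 2 * (norm p)\<^sup>2) \<le> 2 * m * F z"
    using m by (intro mult_left_mono) auto
  moreover have "0 \<le> (norm ?G)\<^sup>2 + 2 * m * (?G \<bullet> p) + m\<^sup>2 * (norm p)\<^sup>2"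
  proof -
    have "(norm (?G + m *\<^sub>R p))\<^sup>2 = (norm ?G)\<^sup>2 + 2 * m * (?G \<bullet> p) + m\<^sup>2 * (norm p)\<^sup>2"
      unfolding power2_norm_eq_inner
      by (simp add: inner_add inner_commute power2_eq_square algebra_simps)
    then show ?thesis by (metis zero_le_power2)
  qed
  ultimately show ?thesis
    by (simp add: algebra_simps power2_eq_square)
qed

text \<open>The space \<open>real^'d\<close> is never trivial, so a unit displacement can be tested.\<close>

lemma convexity_constant_le_lipschitz_constant:
  fixes F :: "real^'d \<Rightarrow> real"
  assumes C2: "continuously_diff 2 F"
    and low: "\<And>y. m \<le> smallest_eigenvalue (hessian F y)"
    and lip: "\<And>y z. norm (gradient F y - gradient F z) \<le> M * norm (y - z)"
  shows "m \<le> M"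
proof -
  obtain p :: "real^'d" where p: "norm p = 1"
    using vector_choose_size[of 1] by auto
  have "m \<le> (gradient F p - gradient F 0) \<bullet> p"
    using gradient_strongly_monotone[OF C2 low, of p 0] p by simp
  also have "\<dots> \<le> norm (gradient F p - gradient F 0) * norm p"
    by (rule norm_cauchy_schwarz)
  also have "\<dots> \<le> M"
    using lip[of p 0] p by simp
  finally show ?thesis .
qed

section \<open>Gradient estimates of relative error below one\<close>

lemma norm_estimate_lower:
  fixes g G :: "'v::real_normed_vector"
  assumes "norm (g - G) \<le> \<theta> * norm G"
  shows "(1 - \<theta>) * norm G \<le> norm g"
  using norm_triangle_sub[of G g] assms by (simp add: norm_minus_commute algebra_simps)

text \<open>Expand \<open>|g - G|\<^sup>2 \<le> \<theta>\<^sup>2 |G|\<^sup>2\<close> and bound \<open>|G|\<close> below by \<open>|g| / (1 + \<theta>)\<close>.\<close>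

lemma inner_estimate_lower:
  fixes g G :: "'v::real_inner"
  assumes acc: "norm (g - G) \<le> \<theta> * norm G" and \<theta>: "0 < \<theta>" "\<theta> < 1"
  shows "(norm g)\<^sup>2 / (1 + \<theta>) \<le> G \<bullet> g"
proof -
  have "norm g \<le> (1 + \<theta>) * norm G"
    using norm_triangle_sub[of g G] acc by (simp add: algebra_simps)
  then have "(norm g)\<^sup>2 \<le> ((1 + \<theta>) * norm G)\<^sup>2"
    by (intro power_mono) auto
  then have "(1 - \<theta>) * (norm g)\<^sup>2 \<le> (1 - \<theta>) * ((1 + \<theta>) * norm G)\<^sup>2"
    using \<theta> by (intro mult_left_mono) auto
  also have "\<dots> = (1 + \<theta>) * ((norm G)\<^sup>2 - (\<theta> * norm G)\<^sup>2)"
    by (simp add: power2_eq_square algebra_simps)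
  also have "\<dots> \<le> (1 + \<theta>) * ((norm G)\<^sup>2 - (norm (g - G))\<^sup>2)"
    using acc \<theta> by (intro mult_left_mono diff_left_mono power_mono) auto
  also have "(norm G)\<^sup>2 - (norm (g - G))\<^sup>2 = 2 * (G \<bullet> g) - (norm g)\<^sup>2"
    unfolding power2_norm_eq_inner by (simp add: inner_diff inner_commute algebra_simps)
  finally have "(norm g)\<^sup>2 \<le> (1 + \<theta>) * (G \<bullet> g)"
    by (simp add: algebra_simps)
  then show ?thesis
    using \<theta> by (simp add: divide_le_eq mult.commute)
qed

section \<open>The line search\<close>

lemma rejected_step_large:
  assumes F: "\<And>y. F differentiable (at y)"
    and lip: "\<And>y z. norm (gradient F y - gradient F z) \<le> M * norm (y - z)"
    and acc: "norm (g - gradient F y) \<le> \<theta> * norm (gradient F y)"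
    and \<theta>: "0 < \<theta>" "\<theta> < 1"
    and l\<^sub>1: "l\<^sub>1 \<le> (1 - \<theta>) / (2 * (1 + \<theta>))"
    and noise: "\<bar>f y s\<^sub>1 - F y\<bar> \<le> \<epsilon>" "\<bar>f (y - \<alpha> *\<^sub>R g) s\<^sub>2 - F (y - \<alpha> *\<^sub>R g)\<bar> \<le> \<epsilon>"
    and \<alpha>: "0 < \<alpha>"
    and rejected: "step_rejected f \<epsilon> l\<^sub>1 y g s\<^sub>1 s\<^sub>2 \<alpha>"
  shows "1 < M * \<alpha>"
proof -
  let ?G = "gradient F y"
  have "F y - l\<^sub>1 * \<alpha> * (norm g)\<^sup>2 < F (y - \<alpha> *\<^sub>R g)"
    using rejected noise unfolding step_rejected_def by linarith
  also have "\<dots> \<le> F y - \<alpha> * (?G \<bullet> g) + M / 2 * (\<alpha>\<^sup>2 * (norm g)\<^sup>2)"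
    using lipschitz_gradient_upper_bound[OF F lip, of y "- \<alpha> *\<^sub>R g"]
    by (simp add: power_mult_distrib)
  also have "\<dots> \<le> F y - \<alpha> * ((norm g)\<^sup>2 / (1 + \<theta>)) + M / 2 * (\<alpha>\<^sup>2 * (norm g)\<^sup>2)"
    using mult_left_mono[OF inner_estimate_lower[OF acc \<theta>], of \<alpha>] \<alpha> by simp
  finally have pos: "0 < \<alpha> * (norm g)\<^sup>2 * (l\<^sub>1 - 1 / (1 + \<theta>) + M * \<alpha> / 2)"
    by (simp add: algebra_simps power2_eq_square)
  then have "g \<noteq> 0"
    by (intro notI) simp
  then have "0 < l\<^sub>1 - 1 / (1 + \<theta>) + M * \<alpha> / 2"
    using \<alpha> by (intro zero_less_mult_pos[OF pos]) simp
  moreover have "1 / (1 + \<theta>) - (1 - \<theta>) / (2 * (1 + \<theta>)) = 1 / 2"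
  proof -
    have "1 / (1 + \<theta>) = (2 * 1) / (2 * (1 + \<theta>))"
      by (rule mult_divide_mult_cancel_left[symmetric]) simp
    then have "1 / (1 + \<theta>) - (1 - \<theta>) / (2 * (1 + \<theta>)) = (2 * 1 - (1 - \<theta>)) / (2 * (1 + \<theta>))"
      by (simp only: diff_divide_distrib)
    also have "\<dots> = 1 / 2"
      using \<theta> by (simp add: divide_eq_eq)
    finally show ?thesis .
  qed
  ultimately show ?thesis
    using l\<^sub>1 by linarith
qed

text \<open>Only step sizes above \<open>1 / M\<close> can be rejected, so the search terminates; the step size before
  the last reduction, if there was one, exceeds \<open>1 / M\<close>.\<close>

lemma backtracking_step_accepted:
  assumes M: "0 < M" and a_init: "0 < a_init" and l\<^sub>2: "0 < l\<^sub>2" "l\<^sub>2 < 1"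
    and large: "\<And>t \<alpha>. 0 < \<alpha> \<Longrightarrow> step_rejected f \<epsilon> l\<^sub>1 y g (s\<^sub>1 t) (s\<^sub>2 t) \<alpha> \<Longrightarrow> 1 < M * \<alpha>"
    and a: "a = backtracking_step f \<epsilon> l\<^sub>1 l\<^sub>2 a_init y g s\<^sub>1 s\<^sub>2"
  shows "\<exists>t. \<not> step_rejected f \<epsilon> l\<^sub>1 y g (s\<^sub>1 t) (s\<^sub>2 t) a" and "l\<^sub>2 / M < a \<or> a = a_init"
proof -
  define P where "P t \<longleftrightarrow> \<not> step_rejected f \<epsilon> l\<^sub>1 y g (s\<^sub>1 t) (s\<^sub>2 t) (l\<^sub>2 ^ t * a_init)" for t
  define T where "T = (LEAST t. P t)"
  have a_T: "a = l\<^sub>2 ^ T * a_init"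
    by (simp add: a backtracking_step_def T_def P_def)
  have rejected: "1 < M * (l\<^sub>2 ^ t * a_init)" if "\<not> P t" for t
    using that a_init l\<^sub>2 large unfolding P_def by simp
  obtain n where "l\<^sub>2 ^ n < 1 / (M * a_init)"
    using real_arch_pow_inv[of "1 / (M * a_init)" l\<^sub>2] M a_init l\<^sub>2 by auto
  then have "P n"
    using rejected[of n] M a_init by (auto simp: field_simps)
  then have "P T"
    unfolding T_def by (rule LeastI)
  then show "\<exists>t. \<not> step_rejected f \<epsilon> l\<^sub>1 y g (s\<^sub>1 t) (s\<^sub>2 t) a"
    unfolding P_def a_T by blast
  show "l\<^sub>2 / M < a \<or> a = a_init"
  proof (cases T)
    case (Suc t)
    then have "\<not> P t"
      using not_less_Least[of t P] by (simp add: T_def)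
    then have "l\<^sub>2 * 1 < l\<^sub>2 * (M * (l\<^sub>2 ^ t * a_init))"
      using l\<^sub>2 by (intro mult_strict_left_mono rejected) auto
    then show ?thesis
      using M by (simp add: a_T Suc divide_less_eq mult_ac)
  qed (simp add: a_T)
qed

lemma accepted_step_decrease:
  assumes noise: "\<bar>f y s\<^sub>1 - F y\<bar> \<le> \<epsilon>" "\<bar>f (y - \<alpha> *\<^sub>R g) s\<^sub>2 - F (y - \<alpha> *\<^sub>R g)\<bar> \<le> \<epsilon>"
    and accepted: "\<not> step_rejected f \<epsilon> l\<^sub>1 y g s\<^sub>1 s\<^sub>2 \<alpha>"
  shows "F (y - \<alpha> *\<^sub>R g) \<le> F y - l\<^sub>1 * \<alpha> * (norm g)\<^sup>2 + 4 * \<epsilon>"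
  using accepted noise unfolding step_rejected_def by linarith

section \<open>Linear convergence up to the noise level\<close>

text \<open>Subtracting the fixed point \<open>b / (1 - \<rho>)\<close> of \<open>d \<mapsto> \<rho> d + b\<close> makes the recursion homogeneous.\<close>

lemma contraction_recursion:
  fixes D :: "nat \<Rightarrow> real"
  assumes \<rho>: "0 \<le> \<rho>" "\<rho> < 1"
    and step: "\<And>k. D (Suc k) \<le> \<rho> * D k + b"
  shows "D k - b / (1 - \<rho>) \<le> \<rho> ^ k * (D 0 - b / (1 - \<rho>))"
proof (induction k)
  case (Suc k)
  have "b / (1 - \<rho>) = \<rho> * (b / (1 - \<rho>)) + b"
    using \<rho> by (simp add: field_simps)
  then have "D (Suc k) - b / (1 - \<rho>) \<le> \<rho> * (D k - b / (1 - \<rho>))"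
    using step[of k] unfolding right_diff_distrib by linarith
  also have "\<dots> \<le> \<rho> * (\<rho> ^ k * (D 0 - b / (1 - \<rho>)))"
    using Suc \<rho> by (intro mult_left_mono)
  finally show ?case by simp
qed simp

theorem theorem4p4:
  fixes \<Omega> :: "'w measure" and \<Xi> :: "'s measure" and H :: "real measure"
    and F :: "real^'d \<Rightarrow> real" and f :: "real^'d \<Rightarrow> 's \<Rightarrow> real"
    and K n\<^sub>b N :: nat
    and h :: "nat \<Rightarrow> 'd \<Rightarrow> nat \<Rightarrow> 'w \<Rightarrow> real"
    and \<xi>\<^sub>1 \<xi>\<^sub>2 :: "nat \<Rightarrow> 'd \<Rightarrow> nat \<Rightarrow> nat \<Rightarrow> 'w \<Rightarrow> 's"
    and J :: "nat \<Rightarrow> 'd \<Rightarrow> nat \<Rightarrow> nat \<Rightarrow> nat \<Rightarrow> 'w \<Rightarrow> nat"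
    and \<zeta>\<^sub>1 \<zeta>\<^sub>2 :: "nat \<Rightarrow> nat \<Rightarrow> 'w \<Rightarrow> 's"
    and x g :: "nat \<Rightarrow> real^'d" and a :: "nat \<Rightarrow> real"
    and x_min :: "real^'d"
    and M m \<epsilon> a_init l\<^sub>1 l\<^sub>2 \<theta> \<rho> :: real
    and \<omega> :: 'w
  assumes sampling: "cor_cfd_sampling \<Omega> \<Xi> H F f K n\<^sub>b N h \<xi>\<^sub>1 \<xi>\<^sub>2 J \<zeta>\<^sub>1 \<zeta>\<^sub>2"
    and outcome: "\<omega> \<in> space \<Omega>"
    and F_C5: "continuously_diff 5 F"
    and F_deriv5: "\<forall>y. deriv_tensor_nonzero 5 F y"
    and M_pos: "0 < M" and m_pos: "0 < m"
    and gradient_lipschitz: "\<forall>y z. norm (gradient F y - gradient F z) \<le> M * norm (y - z)"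
    and hessian_lower: "\<forall>y. m \<le> smallest_eigenvalue (hessian F y)"
    and minimizer: "\<forall>y. F x_min \<le> F y"
    and minimizer_unique: "\<forall>y. (\<forall>z. F y \<le> F z) \<longrightarrow> y = x_min"
    and eps_pos: "0 < \<epsilon>"
    and noise: "\<forall>y. \<forall>s\<in>space \<Xi>. \<bar>f y s - F y\<bar> \<le> \<epsilon>"
    and a_init_pos: "0 < a_init"
    and update: "\<forall>k. x (Suc k) = x k - a k *\<^sub>R g k"
    and estimate: "\<forall>k i. cor_cfd K n\<^sub>b N (\<lambda>r. h k i r \<omega>)
           (\<lambda>r j. cfd_quotient f (x k) i (h k i r \<omega>) (\<xi>\<^sub>1 k i r j \<omega>) (\<xi>\<^sub>2 k i r j \<omega>))
           (\<lambda>r b j. J k i r b j \<omega>) (g k $ i)"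
    and line_search: "\<forall>k. a k = backtracking_step f \<epsilon> l\<^sub>1 l\<^sub>2 a_init (x k) (g k)
           (\<lambda>t. \<zeta>\<^sub>1 k t \<omega>) (\<lambda>t. \<zeta>\<^sub>2 k t \<omega>)"
    and theta: "0 < \<theta>" "\<theta> < 1"
    and accuracy: "\<forall>k. norm (g k - gradient F (x k)) \<le> \<theta> * norm (gradient F (x k))"
    and l_params: "0 < l\<^sub>1" "l\<^sub>1 < l\<^sub>2" "l\<^sub>1 \<le> (1 - \<theta>) / (2 * (1 + \<theta>))"
           "(1 - \<theta>) / (2 * (1 + \<theta>)) \<le> l\<^sub>2" "l\<^sub>2 < 1"
    and rho: "\<rho> = 1 - min (2 * m * l\<^sub>1 * a_init * (1 - \<theta>)\<^sup>2) (2 * m * l\<^sub>1 * l\<^sub>2 * (1 - \<theta>)\<^sup>2 / M)"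
  shows "(\<forall>k. l\<^sub>2 / M < a k \<or> a k = a_init) \<and>
         (\<forall>k. F (x k) - F x_min - 4 * \<epsilon> / (1 - \<rho>)
                \<le> \<rho> ^ k * (F (x 0) - F x_min - 4 * \<epsilon> / (1 - \<rho>)))"
proof -
  interpret cor_cfd_sampling \<Omega> \<Xi> H F f K n\<^sub>b N h \<xi>\<^sub>1 \<xi>\<^sub>2 J \<zeta>\<^sub>1 \<zeta>\<^sub>2
    by (rule sampling)
  have C2: "continuously_diff 2 F"
    using F_C5 by (rule continuously_diff_mono) simp
  have F: "F differentiable (at y)" for y
    using C2 by (simp add: numeral_2_eq_2)
  have lip: "norm (gradient F y - gradient F z) \<le> M * norm (y - z)" for y z
    using gradient_lipschitz by blast
  have low: "m \<le> smallest_eigenvalue (hessian F y)" for y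
    using hessian_lower by blast
  have acc: "norm (g k - gradient F (x k)) \<le> \<theta> * norm (gradient F (x k))" for k
    using accuracy by blast
  have noise1: "\<bar>f y (\<zeta>\<^sub>1 k t \<omega>) - F y\<bar> \<le> \<epsilon>" and noise2: "\<bar>f y (\<zeta>\<^sub>2 k t \<omega>) - F y\<bar> \<le> \<epsilon>" for y k t
    using noise outcome search_measurable[of k t] by (blast dest: measurable_space)+
  have l\<^sub>2: "0 < l\<^sub>2"
    using l_params by linarith
  have large: "1 < M * \<alpha>"
    if "0 < \<alpha>" "step_rejected f \<epsilon> l\<^sub>1 (x k) (g k) (\<zeta>\<^sub>1 k t \<omega>) (\<zeta>\<^sub>2 k t \<omega>) \<alpha>" for k t \<alpha>
    by (rule rejected_step_large[OF F lip acc theta l_params(3) noise1 noise2 that])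
  have accepted: "\<exists>t. \<not> step_rejected f \<epsilon> l\<^sub>1 (x k) (g k) (\<zeta>\<^sub>1 k t \<omega>) (\<zeta>\<^sub>2 k t \<omega>) (a k)"
    and step_size: "l\<^sub>2 / M < a k \<or> a k = a_init" for k
    using backtracking_step_accepted[OF M_pos a_init_pos l\<^sub>2 l_params(5), of f \<epsilon> l\<^sub>1 "x k" "g k"
        "\<lambda>t. \<zeta>\<^sub>1 k t \<omega>" "\<lambda>t. \<zeta>\<^sub>2 k t \<omega>" "a k"] large[of _ k] line_search
    by simp_all

  have \<rho>: "\<rho> < 1" "0 \<le> \<rho>"
  proof -
    have "0 < 2 * m * l\<^sub>1 * a_init * (1 - \<theta>)\<^sup>2" "0 < 2 * m * l\<^sub>1 * l\<^sub>2 * (1 - \<theta>)\<^sup>2 / M"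
      using m_pos M_pos l_params l\<^sub>2 a_init_pos theta by simp_all
    then show "\<rho> < 1" by (simp add: rho)
    have "(1 - \<theta>) / (2 * (1 + \<theta>)) \<le> 1 / 2"
      using theta by (simp add: field_simps)
    then have "2 * l\<^sub>1 \<le> 1"
      using l_params by linarith
    moreover have "m / M \<le> 1"
      using convexity_constant_le_lipschitz_constant[OF C2 low lip] M_pos by simp
    moreover have "(1 - \<theta>)\<^sup>2 \<le> 1"
      using theta by (intro power_le_one) auto
    ultimately have "(m / M) * ((2 * l\<^sub>1) * (l\<^sub>2 * (1 - \<theta>)\<^sup>2)) \<le> 1 * (1 * (1 * 1))"
      using m_pos M_pos l_params(1,5) l\<^sub>2 by (intro mult_mono mult_nonneg_nonneg) simp_all
    then have "2 * m * l\<^sub>1 * l\<^sub>2 * (1 - \<theta>)\<^sup>2 / M \<le> 1"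
      by (simp add: mult_ac)
    then show "0 \<le> \<rho>" by (simp add: rho)
  qed

  define D where "D k = F (x k) - F x_min" for k
  have contraction: "D (Suc k) \<le> \<rho> * D k + 4 * \<epsilon>" for k
  proof -
    let ?G = "gradient F (x k)"
    have a_pos: "0 < a k"
      using step_size[of k] a_init_pos divide_pos_pos[OF l\<^sub>2 M_pos] by linarith
    have D_nonneg: "0 \<le> D k"
      using minimizer by (simp add: D_def)
    obtain t where "\<not> step_rejected f \<epsilon> l\<^sub>1 (x k) (g k) (\<zeta>\<^sub>1 k t \<omega>) (\<zeta>\<^sub>2 k t \<omega>) (a k)"
      using accepted by blast
    then have decrease: "F (x (Suc k)) \<le> F (x k) - l\<^sub>1 * a k * (norm (g k))\<^sup>2 + 4 * \<epsilon>"
      using accepted_step_decrease[where f = f, OF noise1[of "x k"] noise2[of "x k - a k *\<^sub>R g k"]]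
        update by simp
    have "((1 - \<theta>) * norm ?G)\<^sup>2 \<le> (norm (g k))\<^sup>2"
      using norm_estimate_lower[OF acc] theta by (intro power_mono) auto
    moreover have "2 * m * D k \<le> (norm ?G)\<^sup>2"
      unfolding D_def by (rule gradient_dominates_gap[OF C2 m_pos low])
    then have "(1 - \<theta>)\<^sup>2 * (2 * m * D k) \<le> ((1 - \<theta>) * norm ?G)\<^sup>2"
      by (simp add: power_mult_distrib mult_left_mono)
    ultimately have "(1 - \<theta>)\<^sup>2 * (2 * m * D k) \<le> (norm (g k))\<^sup>2"
      by linarith
    then have "l\<^sub>1 * a k * ((1 - \<theta>)\<^sup>2 * (2 * m * D k)) \<le> l\<^sub>1 * a k * (norm (g k))\<^sup>2"
      using l_params a_pos by (intro mult_left_mono) auto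
    moreover have "(1 - \<rho>) * D k \<le> l\<^sub>1 * a k * ((1 - \<theta>)\<^sup>2 * (2 * m * D k))"
    proof -
      \<comment> \<open>Either alternative for the step size makes \<open>c * a k\<close> at least one term of the minimum.\<close>
      define c where "c = 2 * m * l\<^sub>1 * (1 - \<theta>)\<^sup>2"
      have "0 \<le> c"
        using m_pos l_params by (simp add: c_def)
      have "1 - \<rho> = min (c * a_init) (c * (l\<^sub>2 / M))"
        by (simp add: rho c_def mult_ac)
      also have "\<dots> \<le> c * a k"
        using step_size[of k] mult_left_mono[OF _ \<open>0 \<le> c\<close>, of "l\<^sub>2 / M" "a k"]
        by (auto simp: min_le_iff_disj)
      finally have "(1 - \<rho>) * D k \<le> c * a k * D k"
        using D_nonneg by (rule mult_right_mono)
      then show ?thesis by (simp add: c_def mult_ac)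
    qed
    ultimately show ?thesis
      using decrease by (simp add: D_def algebra_simps)
  qed
  have "D k - 4 * \<epsilon> / (1 - \<rho>) \<le> \<rho> ^ k * (D 0 - 4 * \<epsilon> / (1 - \<rho>))" for k
    by (rule contraction_recursion[where D = D, OF \<rho>(2,1) contraction])
  then show ?thesis
    using step_size by (simp add: D_def)
qed

end
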